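(* The generating function for the number of restricted growth sequences of length $n$ ($n\ge 0$) that avoid $\{12313,12323\}$ is $$\sum_{n\ge0}|\mathcal P_n(\{12313,12323\})|\,x^n=\frac{1}{1-x}+\frac{x}{2(1-x)}\left(\frac{1}{\sqrt{1-4x}}-1\right).$$
   Context: A restricted growth sequence of length $n$ is a sequence of positive integers $\pi=\pi_1\cdots\pi_n$ with $\pi_1=1$ and $\pi_{j+1}\le 1+\max\{\pi_1,\dots,\pi_j\}$ for all $1\le j<n$ (the empty sequence is the only one of length $0$). Such a sequence contains a pattern $\tau$ if it has a (not necessarily consecutive) subsequence order isomorphic to $\tau$ (same relative order, including equalities); otherwise it avoids $\tau$. $\mathcal P_n(B)$ is the set of restricted growth sequences of length $n$ that avoid all patterns in $B$. *)

theory Defs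
  imports
    Complex_Main
    "HOL-Library.Sublist"
    "HOL-Computational_Algebra.Formal_Power_Series"
begin

text \<open>Sequences are lists over \<open>nat\<close>; list positions are 0-based, so \<open>\<pi> ! j\<close> is the entry
  \<open>\<pi>\<^sub>j\<^sub>+\<^sub>1\<close>, and \<open>take j \<pi>\<close> lists the entries before it.\<close>

definition restricted_growth :: "nat list \<Rightarrow> bool" where
  "restricted_growth \<pi> \<longleftrightarrow>
     (\<forall>a \<in> set \<pi>. 1 \<le> a) \<and>
     (\<pi> \<noteq> [] \<longrightarrow> \<pi> ! 0 = 1) \<and>
     (\<forall>j. 1 \<le> j \<and> j < length \<pi> \<longrightarrow> \<pi> ! j \<le> 1 + Max (set (take j \<pi>)))"

definition order_isomorphic :: "nat list \<Rightarrow> nat list \<Rightarrow> bool" where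
  "order_isomorphic \<sigma> \<tau> \<longleftrightarrow>
     length \<sigma> = length \<tau> \<and>
     (\<forall>i < length \<tau>. \<forall>j < length \<tau>.
        (\<sigma> ! i < \<sigma> ! j \<longleftrightarrow> \<tau> ! i < \<tau> ! j) \<and> (\<sigma> ! i = \<sigma> ! j \<longleftrightarrow> \<tau> ! i = \<tau> ! j))"

definition contains_pattern :: "nat list \<Rightarrow> nat list \<Rightarrow> bool" where
  "contains_pattern \<pi> \<tau> \<longleftrightarrow> (\<exists>\<sigma>. subseq \<sigma> \<pi> \<and> order_isomorphic \<sigma> \<tau>)"

definition avoiding_rgs :: "nat \<Rightarrow> nat list set \<Rightarrow> nat list set" where
  "avoiding_rgs n B =
     {\<pi>. length \<pi> = n \<and> restricted_growth \<pi> \<and> (\<forall>\<tau> \<in> B. \<not> contains_pattern \<pi> \<tau>)}"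

end

theory Submission
  imports Defs
begin

text \<open>
  In a restricted growth sequence \<open>1, \<dots>, c - 1\<close> occur, in this order, before the first \<open>c\<close>.
  Hence the first three letters of either pattern come for free: as soon as some \<open>c \<ge> 3\<close> occurs
  twice with a smaller letter \<open>y\<close> in between, one of the patterns occurs (12313 if \<open>y = 1\<close>, 12323
  if \<open>y > 1\<close>), and conversely (\<open>avoids_iff_sandwich_free\<close>).

  Now scan such a sequence from left to right. Call a letter \<open>c \<ge> 3\<close> of the prefix open if no
  smaller letter has followed it. Once 2 has occurred, the letters that may come next are
  1, 2, the open letters, and the next new letter. Writing 1 or 2 closes all open letters, writing
  the \<open>i\<close>-th smallest open letter leaves \<open>i\<close> of them, and a new letter adds one. So the number
  of extensions by \<open>r\<close> letters depends only on the number \<open>k\<close> of open letters: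
  \<open>W (r + 1) k = 2 * W r 0 + (\<Sum>i=1..k+1. W r i)\<close> and \<open>W 0 k = 1\<close>, with solution
  \<open>W r k = (2 * r + 1 + k choose r)\<close> (\<open>card_extensions\<close>). Splitting a nonempty sequence at its
  first 2, if there is one, gives \<open>1 + (\<Sum>i<n. 2 * i + 1 choose i)\<close> sequences of length \<open>n + 1\<close>
  (\<open>card_avoiding_rgs\<close>).

  Since \<open>(2 * i + 1 choose i)\<close> is half the central binomial coefficient at \<open>i + 1\<close>, the generating
  function follows from \<open>1 / sqrt (1 - 4 * x) = (\<Sum>n. (2 * n choose n) * x ^ n)\<close>
  (\<open>inverse_sqrt_fps\<close>).
\<close>

section \<open>Restricted growth sequences\<close>

text \<open>The largest letter, with value 0 for the empty word. This choice lets the growth condition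
  \<open>x \<le> Suc (maxl w)\<close> also force the first letter to be 1.\<close>

definition maxl :: "nat list \<Rightarrow> nat" where
  "maxl w = Max (insert 0 (set w))"

lemma maxl_ge: "a \<in> set w \<Longrightarrow> a \<le> maxl w"
  by (simp add: maxl_def)

lemma maxl_in: "0 < maxl w \<Longrightarrow> maxl w \<in> set w"
  using Max_in[of "insert 0 (set w)"] by (auto simp: maxl_def)

lemma maxl_eq_Max: "w \<noteq> [] \<Longrightarrow> maxl w = Max (set w)"
  by (simp add: maxl_def)

lemma restricted_growth_Nil [simp]: "restricted_growth []"
  by (simp add: restricted_growth_def)

lemma restricted_growth_snoc:
  "restricted_growth (w @ [x]) \<longleftrightarrow> restricted_growth w \<and> 1 \<le> x \<and> x \<le> Suc (maxl w)"
proof (cases "w = []")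
  case True
  then show ?thesis by (auto simp: restricted_growth_def maxl_def)
next
  case False
  have "(\<forall>j. 1 \<le> j \<and> j < length (w @ [x]) \<longrightarrow> (w @ [x]) ! j \<le> 1 + Max (set (take j (w @ [x])))) \<longleftrightarrow>
     (\<forall>j. 1 \<le> j \<and> j < length w \<longrightarrow> w ! j \<le> 1 + Max (set (take j w))) \<and> x \<le> Suc (Max (set w))"
    (is "?L \<longleftrightarrow> ?R")
  proof
    assume L: ?L
    have "w ! j \<le> 1 + Max (set (take j w))" if "1 \<le> j" "j < length w" for j
      using L[rule_format, of j] that by (simp add: nth_append)
    moreover have "x \<le> Suc (Max (set w))"
      using L[rule_format, of "length w"] False by (simp add: Suc_le_eq)
    ultimately show ?R by blast
  next
    assume ?R
    then show ?L by (auto simp: nth_append less_Suc_eq)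
  qed
  then show ?thesis
    using False by (auto simp: restricted_growth_def maxl_eq_Max nth_append)
qed

lemma restricted_growth_appendD: "restricted_growth (w @ v) \<Longrightarrow> restricted_growth w"
  by (induction v rule: rev_induct)
    (auto simp: restricted_growth_snoc simp flip: append_assoc)

lemma restricted_growth_pos: "restricted_growth w \<Longrightarrow> a \<in> set w \<Longrightarrow> 1 \<le> a"
  by (simp add: restricted_growth_def)

lemma subseq_set_subset: "subseq u w \<Longrightarrow> set u \<subseteq> set w"
  by (induction rule: list_emb.induct) auto

lemma restricted_growth_subseq_less:
  assumes "restricted_growth w" "b \<in> set w" "1 \<le> a" "a < b"
  shows "subseq [a, b] w"
  using assms
proof (induction w arbitrary: b rule: rev_induct)
  case (snoc x w)
  note rg = snoc.prems(1)[unfolded restricted_growth_snoc]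
  show ?case
  proof (cases "b \<in> set w")
    case True
    then show ?thesis using snoc.IH rg snoc.prems by (auto intro: subseq_rev_drop_many)
  next
    case False
    with snoc.prems have b: "b = x" by simp
    with rg snoc.prems have le: "a \<le> maxl w" by simp
    with snoc.prems have M: "maxl w \<in> set w" by (intro maxl_in) simp
    have "a \<in> set w"
    proof (cases "a = maxl w")
      case True with M show ?thesis by simp
    next
      case False
      then have "subseq [a, maxl w] w" using snoc.IH[OF _ M] rg snoc.prems le by simp
      then show ?thesis using subseq_set_subset by fastforce
    qed
    then have "subseq ([a] @ [b]) (w @ [x])"
      unfolding b by (subst subseq_append) (simp add: subseq_singleton_left)
    then show ?thesis by simp
  qed
qed simp

lemma subseq_snoc_iff:
  "subseq (u @ [a]) (w @ [x]) \<longleftrightarrow> subseq (u @ [a]) w \<or> (a = x \<and> subseq u w)"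
proof
  assume "subseq (u @ [a]) (w @ [x])"
  then obtain p q where pq: "u @ [a] = p @ q" "subseq p w" "subseq q [x]"
    by (auto simp: subseq_append_iff)
  show "subseq (u @ [a]) w \<or> (a = x \<and> subseq u w)"
  proof (cases q rule: rev_cases)
    case Nil
    with pq show ?thesis by simp
  next
    case (snoc q' z)
    with pq have "q' = []" "z = x"
      using list_emb_length[OF pq(3)] subseq_set_subset[OF pq(3)] by auto
    with snoc pq show ?thesis by auto
  qed
next
  assume "subseq (u @ [a]) w \<or> (a = x \<and> subseq u w)"
  then show "subseq (u @ [a]) (w @ [x])"
    by (auto intro: subseq_rev_drop_many)
qed

section \<open>Avoidance as a condition on pairs of equal letters\<close>

text \<open>No two occurrences of a letter \<open>c \<ge> 3\<close> have a smaller letter between them.\<close>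

definition sandwich_free :: "nat list \<Rightarrow> bool" where
  "sandwich_free w \<longleftrightarrow> (\<forall>c y. 3 \<le> c \<and> y < c \<longrightarrow> \<not> subseq [c, y, c] w)"

lemma order_isomorphic_12313:
  "order_isomorphic \<sigma> [1,2,3,1,3] \<longleftrightarrow> (\<exists>a b c. \<sigma> = [a,b,c,a,c] \<and> a < b \<and> b < c)"
proof
  assume h: "order_isomorphic \<sigma> [1,2,3,1,3]"
  then have "length \<sigma> = 5" by (simp add: order_isomorphic_def)
  then obtain a b c d e where s: "\<sigma> = [a,b,c,d,e]"
    by (auto simp: length_Suc_conv numeral_eq_Suc)
  have P: "(\<sigma> ! i < \<sigma> ! j \<longleftrightarrow> [1,2,3,1,3::nat] ! i < [1,2,3,1,3] ! j) \<and>
      (\<sigma> ! i = \<sigma> ! j \<longleftrightarrow> [1,2,3,1,3::nat] ! i = [1,2,3,1,3] ! j)" if "i < 5" "j < 5" for i j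
    using h that by (simp add: order_isomorphic_def)
  show "\<exists>a b c. \<sigma> = [a,b,c,a,c] \<and> a < b \<and> b < c"
    using P[of 0 1] P[of 1 2] P[of 0 3] P[of 2 4] by (simp add: s)
next
  assume "\<exists>a b c. \<sigma> = [a,b,c,a,c] \<and> a < b \<and> b < c"
  then show "order_isomorphic \<sigma> [1,2,3,1,3]"
    by (elim exE conjE, simp add: order_isomorphic_def numeral_eq_Suc All_less_Suc)
qed

lemma order_isomorphic_12323:
  "order_isomorphic \<sigma> [1,2,3,2,3] \<longleftrightarrow> (\<exists>a b c. \<sigma> = [a,b,c,b,c] \<and> a < b \<and> b < c)"
proof
  assume h: "order_isomorphic \<sigma> [1,2,3,2,3]"
  then have "length \<sigma> = 5" by (simp add: order_isomorphic_def)
  then obtain a b c d e where s: "\<sigma> = [a,b,c,d,e]"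
    by (auto simp: length_Suc_conv numeral_eq_Suc)
  have P: "(\<sigma> ! i < \<sigma> ! j \<longleftrightarrow> [1,2,3,2,3::nat] ! i < [1,2,3,2,3] ! j) \<and>
      (\<sigma> ! i = \<sigma> ! j \<longleftrightarrow> [1,2,3,2,3::nat] ! i = [1,2,3,2,3] ! j)" if "i < 5" "j < 5" for i j
    using h that by (simp add: order_isomorphic_def)
  show "\<exists>a b c. \<sigma> = [a,b,c,b,c] \<and> a < b \<and> b < c"
    using P[of 0 1] P[of 1 2] P[of 1 3] P[of 2 4] by (simp add: s)
next
  assume "\<exists>a b c. \<sigma> = [a,b,c,b,c] \<and> a < b \<and> b < c"
  then show "order_isomorphic \<sigma> [1,2,3,2,3]"
    by (elim exE conjE, simp add: order_isomorphic_def numeral_eq_Suc All_less_Suc)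
qed

lemma avoids_iff_sandwich_free:
  assumes rg: "restricted_growth \<pi>"
  shows "(\<forall>\<tau> \<in> {[1,2,3,1,3], [1,2,3,2,3]}. \<not> contains_pattern \<pi> \<tau>) \<longleftrightarrow> sandwich_free \<pi>"
proof
  assume sf: "sandwich_free \<pi>"
  have *: False if s: "subseq [a,b,c,y,c] \<pi>" and "a < b" "b < c" "y < c" for a b c y
  proof -
    have "subseq [c,y,c] \<pi>" using s by (meson subseq_Cons')
    moreover have "a \<in> set \<pi>" using subseq_set_subset[OF s] by simp
    ultimately show False
      using sf restricted_growth_pos[OF rg, of a] that by (fastforce simp: sandwich_free_def)
  qed
  show "\<forall>\<tau> \<in> {[1,2,3,1,3], [1,2,3,2,3]}. \<not> contains_pattern \<pi> \<tau>"
    unfolding contains_pattern_def ball_simps insert_iff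
    by (auto simp: order_isomorphic_12313[simplified] order_isomorphic_12323[simplified] dest: *)
next
  assume av: "\<forall>\<tau> \<in> {[1,2,3,1,3], [1,2,3,2,3]}. \<not> contains_pattern \<pi> \<tau>"
  show "sandwich_free \<pi>"
    unfolding sandwich_free_def
  proof (intro allI impI notI, elim conjE)
    fix c y assume c: "3 \<le> c" "y < c" and s: "subseq [c, y, c] \<pi>"
    then have "c \<in> set \<pi>" using subseq_set_subset by fastforce
    \<comment> \<open>Split at the first \<open>c\<close>: each smaller positive letter occurs in \<open>p\<close>, and \<open>y\<close>, \<open>c\<close> follow in \<open>q\<close>.\<close>
    then obtain p q where pi: "\<pi> = p @ c # q" and cp: "c \<notin> set p"
      by (metis split_list_first)
    have "subseq [c, y, c] (c # q)"
      using s cp unfolding pi by (induction p) (auto split: if_splits)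
    then have "subseq ([y] @ [c]) q" by simp
    have rgp: "restricted_growth (p @ [c])"
      using rg restricted_growth_appendD[of "p @ [c]" q] by (simp add: pi)
    have y: "1 \<le> y" using subseq_set_subset[OF s] restricted_growth_pos[OF rg, of y] by simp
    have below: "b \<in> set p" if "1 \<le> b" "b < c" for b
    proof -
      have "subseq ([b] @ [c]) (p @ [c])"
        using restricted_growth_subseq_less[OF rgp, of c b] that by simp
      then show ?thesis
        unfolding subseq_snoc_iff using cp subseq_set_subset[of "[b, c]" p]
        by (auto simp: subseq_singleton_left)
    qed
    have pre: "subseq [1, b] p" if "1 < b" "b < c" for b
      using restricted_growth_subseq_less[OF restricted_growth_appendD[OF rgp], of b 1]
        below[of b] that by simp
    have occ: "subseq [1, b, c, y, c] \<pi>" if "1 < b" "b < c" for b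
    proof -
      have "subseq ([1, b] @ (c # [y, c])) (p @ (c # q))"
        using pre[OF that] \<open>subseq ([y] @ [c]) q\<close> by (intro list_emb_append_mono) auto
      then show ?thesis by (simp add: pi)
    qed
    show False
    proof (cases "y = 1")
      case True
      have "contains_pattern \<pi> [1,2,3,1,3]"
        unfolding contains_pattern_def order_isomorphic_12313
        using occ[of 2] c True by (intro exI[of _ "[1,2,c,1,c]"]) auto
      with av show False by blast
    next
      case False
      have "contains_pattern \<pi> [1,2,3,2,3]"
        unfolding contains_pattern_def order_isomorphic_12323
        using occ[of y] c y False by (intro exI[of _ "[1,y,c,y,c]"]) auto
      with av show False by blast
    qed
  qed
qed

section \<open>Extending admissible prefixes\<close>

text \<open>The sequences to be counted.\<close>

definition admissible :: "nat list \<Rightarrow> bool" where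
  "admissible w \<longleftrightarrow> restricted_growth w \<and> sandwich_free w"

text \<open>The letters \<open>c \<ge> 3\<close> of \<open>w\<close> that have not been followed by a smaller letter. For admissible
  \<open>w\<close> these are the letters \<open>\<ge> 3\<close> of \<open>w\<close> that may be written again.\<close>

definition open_letters :: "nat list \<Rightarrow> nat set" where
  "open_letters w = {c \<in> set w. 3 \<le> c \<and> (\<forall>y<c. \<not> subseq [c, y] w)}"

text \<open>The words of length \<open>r\<close> that continue \<open>w\<close> to an admissible sequence; the prefix \<open>w\<close> itself
  is not part of them.\<close>

definition extensions :: "nat list \<Rightarrow> nat \<Rightarrow> nat list set" where
  "extensions w r = {v. length v = r \<and> admissible (w @ v)}"

lemma admissible_appendD: "admissible (w @ v) \<Longrightarrow> admissible w"
  by (auto simp: admissible_def sandwich_free_def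
      dest: restricted_growth_appendD intro: subseq_rev_drop_many)

lemma sandwich_free_snoc:
  "sandwich_free (w @ [x]) \<longleftrightarrow>
     sandwich_free w \<and> (3 \<le> x \<longrightarrow> (\<forall>y<x. \<not> subseq [x, y] w))"
  using subseq_snoc_iff[of "[_, _]" _ w x] by (auto simp: sandwich_free_def)

lemma admissible_snoc:
  assumes "admissible w"
  shows "admissible (w @ [x]) \<longleftrightarrow>
    1 \<le> x \<and> x \<le> Suc (maxl w) \<and> (3 \<le> x \<longrightarrow> (\<forall>y<x. \<not> subseq [x, y] w))"
  using assms by (auto simp: admissible_def restricted_growth_snoc sandwich_free_snoc)

lemma finite_next: "finite {x. admissible (w @ [x])}"
  by (rule finite_subset[of _ "{..Suc (maxl w)}"])
    (auto simp: admissible_def restricted_growth_snoc)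

lemma extensions_Suc:
  "extensions w (Suc r) = (\<Union>x \<in> {x. admissible (w @ [x])}. (#) x ` extensions (w @ [x]) r)"
proof (intro set_eqI iffI)
  fix v assume v: "v \<in> extensions w (Suc r)"
  then obtain x u where "v = x # u" by (cases v) (auto simp: extensions_def)
  with v admissible_appendD[of "w @ [x]" u]
  show "v \<in> (\<Union>x \<in> {x. admissible (w @ [x])}. (#) x ` extensions (w @ [x]) r)"
    by (auto simp: extensions_def)
qed (auto simp: extensions_def)

lemma finite_extensions: "finite (extensions w r)"
proof (induction r arbitrary: w)
  case 0
  show ?case by (rule finite_subset[of _ "{[]}"]) (auto simp: extensions_def)
qed (simp add: extensions_Suc finite_next)

lemma card_extensions_0: "admissible w \<Longrightarrow> card (extensions w 0) = 1"
proof -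
  assume "admissible w"
  then have "extensions w 0 = {[]}" by (auto simp: extensions_def)
  then show ?thesis by simp
qed

lemma card_extensions_Suc:
  "card (extensions w (Suc r)) = (\<Sum>x | admissible (w @ [x]). card (extensions (w @ [x]) r))"
proof -
  have "card (extensions w (Suc r)) =
      (\<Sum>x | admissible (w @ [x]). card ((#) x ` extensions (w @ [x]) r))"
    unfolding extensions_Suc
    by (rule card_UN_disjoint) (use finite_next finite_extensions in \<open>auto\<close>)
  then show ?thesis by (simp add: card_image)
qed

lemma subseq_pair_snoc:
  "subseq [c, y] (w @ [x]) \<longleftrightarrow> subseq [c, y] w \<or> (y = x \<and> c \<in> set w)"
  using subseq_snoc_iff[of "[c]" y w x] by (simp add: subseq_singleton_left)

lemma subseq_pair_fstD: "subseq [c, y] w \<Longrightarrow> c \<in> set w"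
  using subseq_set_subset[of "[c, y]" w] by simp

lemma open_letters_snoc:
  assumes "admissible (w @ [x])"
  shows "open_letters (w @ [x]) = {c \<in> open_letters w. c \<le> x} \<union> (if 3 \<le> x then {x} else {})"
proof -
  have x: "3 \<le> x \<Longrightarrow> y < x \<Longrightarrow> \<not> subseq [x, y] w" for y
    using assms by (simp add: admissible_def sandwich_free_snoc)
  have "(\<forall>y<c. \<not> (subseq [c, y] w \<or> (y = x \<and> c \<in> set w))) \<longleftrightarrow>
      (\<forall>y<c. \<not> subseq [c, y] w) \<and> c \<le> x" if "c \<in> set w" for c
    using that by (metis leD leI)
  moreover have "c \<notin> set w \<Longrightarrow> \<not> subseq [c, y] w" for c y
    using subseq_pair_fstD[of c y w] by blast
  ultimately show ?thesis
    using x unfolding open_letters_def subseq_pair_snoc by auto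
qed

text \<open>Summing over the elements of \<open>D\<close> a function of their rank in \<open>D\<close>. It applies to the letters
  \<open>d \<ge> 3\<close> that may come next, since the rank of \<open>d\<close> among them is the number of open letters after
  \<open>d\<close> has been written.\<close>

lemma sum_rank:
  fixes f :: "nat \<Rightarrow> nat" and D :: "nat set"
  assumes "finite D"
  shows "(\<Sum>d\<in>D. f (card {e \<in> D. e \<le> d})) = (\<Sum>i=1..card D. f i)"
  using assms
proof (induction D rule: finite_linorder_max_induct)
  case (insert b A)
  have b: "b \<notin> A" using insert.hyps by auto
  have "{e \<in> insert b A. e \<le> b} = insert b A" using insert.hyps by (auto intro: less_imp_le)
  moreover have "{e \<in> insert b A. e \<le> d} = {e \<in> A. e \<le> d}" if "d \<in> A" for d
    using insert.hyps that by fastforce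
  ultimately show ?case
    using insert b by simp
qed simp

lemma binomial_sum_step:
  "2 * (2 * r + 1 choose r) + (\<Sum>i=1..Suc k. (2 * r + 1 + i choose r)) = (2 * r + 3 + k choose Suc r)"
proof (induction k)
  case 0
  have "(2 * r + 1 choose Suc r) = (2 * r + 1 choose r)"
    using binomial_symmetric[of r "2 * r + 1"] by simp
  then show ?case by (simp add: numeral_eq_Suc)
next
  case (Suc k)
  then show ?case by (simp add: numeral_eq_Suc)
qed

text \<open>The hypothesis \<open>2 \<in> set w\<close> makes both 1 and 2 old letters, which are always allowed, and the
  next new letter at least 3. The new letter joins the open letters in the set \<open>D\<close> below; being
  the largest element of \<open>D\<close>, its rank is again the number of open letters after it is written.\<close>

lemma card_extensions:
  assumes "admissible w" "2 \<in> set w"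
  shows "card (extensions w r) = (2 * r + 1 + card (open_letters w) choose r)"
  using assms
proof (induction r arbitrary: w)
  case 0
  then show ?case by (simp add: card_extensions_0)
next
  case (Suc r)
  define m where "m = maxl w"
  define D where "D = insert (Suc m) (open_letters w)"
  have m: "2 \<le> m" using maxl_ge[OF Suc.prems(2)] by (simp add: m_def)
  have fin: "finite (open_letters w)" by (simp add: open_letters_def)
  have new: "Suc m \<notin> set w" using maxl_ge[of "Suc m" w] by (auto simp: m_def)
  have le_m: "c \<le> m" if "c \<in> open_letters w" for c
    using that maxl_ge[of c w] by (simp add: open_letters_def m_def)
  have rg: "restricted_growth w" using Suc.prems by (simp add: admissible_def)
  have used: "x \<in> set w" if "1 \<le> x" "x \<le> m" for x
  proof (cases "x = m")
    case True
    then show ?thesis using maxl_in[of w] m by (simp add: m_def)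
  next
    case False
    then have "subseq [x, m] w"
      using restricted_growth_subseq_less[OF rg, of m x] maxl_in[of w] m that by (simp add: m_def)
    then show ?thesis by (rule subseq_pair_fstD)
  qed
  have "{x. admissible (w @ [x])} = {1, 2} \<union> D"
  proof (intro set_eqI iffI)
    fix x assume "x \<in> {x. admissible (w @ [x])}"
    then have x: "1 \<le> x" "x \<le> Suc m" "3 \<le> x \<longrightarrow> (\<forall>y<x. \<not> subseq [x, y] w)"
      using admissible_snoc[OF Suc.prems(1)] by (auto simp: m_def)
    have "x \<in> open_letters w" if "3 \<le> x" "x \<le> m"
      using that x used[of x] by (simp add: open_letters_def)
    then show "x \<in> {1, 2} \<union> D" using x by (force simp: D_def)
  next
    fix x assume "x \<in> {1, 2} \<union> D"
    then consider "x \<in> {1, 2}" | "x = Suc m" | "x \<in> open_letters w" by (auto simp: D_def)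
    then have "1 \<le> x \<and> x \<le> Suc m \<and> (3 \<le> x \<longrightarrow> (\<forall>y<x. \<not> subseq [x, y] w))"
    proof cases
      case 1
      then show ?thesis using m by auto
    next
      case 2
      then show ?thesis using new by (auto dest: subseq_pair_fstD)
    next
      case 3
      then show ?thesis using le_m[OF 3] by (auto simp: open_letters_def)
    qed
    then show "x \<in> {x. admissible (w @ [x])}"
      using admissible_snoc[OF Suc.prems(1)] by (simp add: m_def)
  qed
  moreover have D3: "3 \<le> d" if "d \<in> D" for d
    using that m by (auto simp: D_def open_letters_def)
  ultimately have adm: "admissible (w @ [x]) \<longleftrightarrow> x \<in> {1, 2} \<union> D" for x by blast
  have ol12: "open_letters (w @ [x]) = {}" if "x \<in> {1, 2}" for x
    using that adm[of x] by (subst open_letters_snoc) (auto simp: open_letters_def)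
  have olD: "open_letters (w @ [d]) = {e \<in> D. e \<le> d}" if "d \<in> D" for d
    using that adm[of d] D3[of d]
    by (subst open_letters_snoc) (auto simp: D_def dest: le_m)
  have "card (extensions w (Suc r)) = (\<Sum>x\<in>{1, 2} \<union> D. card (extensions (w @ [x]) r))"
    unfolding card_extensions_Suc using adm by (intro sum.cong) auto
  also have "\<dots> = (\<Sum>x\<in>{1, 2} \<union> D. 2 * r + 1 + card (open_letters (w @ [x])) choose r)"
    using Suc.IH adm Suc.prems by (intro sum.cong) auto
  also have "\<dots> = (\<Sum>x\<in>{1, 2}. 2 * r + 1 + card (open_letters (w @ [x])) choose r) +
      (\<Sum>d\<in>D. 2 * r + 1 + card (open_letters (w @ [d])) choose r)"
    using fin m D3[of 1] D3[of 2] by (intro sum.union_disjoint) (auto simp: D_def)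
  also have "\<dots> = 2 * (2 * r + 1 choose r) +
      (\<Sum>d\<in>D. 2 * r + 1 + card {e \<in> D. e \<le> d} choose r)"
    using ol12 olD by simp
  also have "\<dots> = 2 * (2 * r + 1 choose r) + (\<Sum>i=1..card D. 2 * r + 1 + i choose r)"
    using fin by (subst sum_rank) (auto simp: D_def)
  also have "card D = Suc (card (open_letters w))"
    unfolding D_def by (rule card_insert_disjoint) (use fin le_m[of "Suc m"] in auto)
  also have "2 * (2 * r + 1 choose r) +
      (\<Sum>i=1..Suc (card (open_letters w)). 2 * r + 1 + i choose r) =
      (2 * r + 3 + card (open_letters w) choose Suc r)"
    by (rule binomial_sum_step)
  finally show ?case by (simp add: numeral_eq_Suc)
qed

lemma maxl_replicate_1: "maxl (replicate (Suc j) 1) = 1"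
  by (induction j) (simp_all add: maxl_def)

lemma admissible_replicate_1: "admissible (replicate j 1)"
proof (induction j)
  case 0
  show ?case by (simp add: admissible_def sandwich_free_def)
next
  case (Suc j)
  have "admissible (replicate j 1 @ [1])"
    using Suc by (simp add: admissible_snoc)
  then show ?case by (simp add: replicate_append_same)
qed

text \<open>After a nonempty block of ones, the next letter is 1, which prolongs the block, or 2, which
  starts the regime of \<open>card_extensions\<close> with no open letter.\<close>

lemma card_extensions_replicate_1:
  "card (extensions (replicate (Suc j) 1) r) = 1 + (\<Sum>i<r. 2 * i + 1 choose i)"
proof (induction r arbitrary: j)
  case 0
  show ?case using card_extensions_0[OF admissible_replicate_1[of "Suc j"]] by simp
next
  case (Suc r)
  let ?w = "replicate (Suc j) (1::nat)"
  have adm: "admissible (?w @ [x]) \<longleftrightarrow> x \<in> {1, 2}" for x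
    unfolding admissible_snoc[OF admissible_replicate_1] maxl_replicate_1 by auto
  have "{x. admissible (?w @ [x])} = {1, 2}" using adm by blast
  then have "card (extensions ?w (Suc r)) =
      card (extensions (?w @ [1]) r) + card (extensions (?w @ [2]) r)"
    unfolding card_extensions_Suc by simp
  also have "?w @ [1] = replicate (Suc (Suc j)) 1"
    by (simp add: replicate_append_same)
  also have "open_letters (?w @ [2]) = {}"
    by (auto simp: open_letters_def)
  then have "card (extensions (?w @ [2]) r) = (2 * r + 1 choose r)"
    using card_extensions[of "?w @ [2]" r] adm by simp
  finally show ?case using Suc.IH[of "Suc j"] by simp
qed

lemma card_avoiding_rgs:
  "card (avoiding_rgs n {[1,2,3,1,3], [1,2,3,2,3]}) =
    (case n of 0 \<Rightarrow> 1 | Suc r \<Rightarrow> 1 + (\<Sum>i<r. 2 * i + 1 choose i))"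
proof -
  have eq: "avoiding_rgs n {[1,2,3,1,3], [1,2,3,2,3]} = extensions [] n"
    unfolding avoiding_rgs_def extensions_def admissible_def
    using avoids_iff_sandwich_free by auto
  have adm: "admissible []" using admissible_replicate_1[of 0] by simp
  show ?thesis
  proof (cases n)
    case 0
    then show ?thesis unfolding eq using card_extensions_0[OF adm] by simp
  next
    case (Suc r)
    have "admissible ([] @ [x]) \<longleftrightarrow> x = 1" for x
      unfolding admissible_snoc[OF adm] by (auto simp: maxl_def)
    then have "{x. admissible ([] @ [x])} = {1}" by auto
    then have "card (extensions [] (Suc r)) = card (extensions [1] r)"
      unfolding card_extensions_Suc by simp
    then show ?thesis unfolding eq using card_extensions_replicate_1[of 0 r] Suc by simp
  qed
qed

section \<open>The generating function\<close>

lemma gbinomial_minus_half: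
  "(- 4) ^ n * ((- 1 / 2 :: real) gchoose n) = real (2 * n choose n)"
proof (induction n)
  case (Suc n)
  have *: "real (Suc n) * ((- 1 / 2 :: real) gchoose Suc n) = (- 1 / 2 - real n) * ((- 1 / 2) gchoose n)"
    using gbinomial_absorb_comp[of "- 1 / 2 :: real" n] gbinomial_absorption[of n "- 1 / 2 :: real"]
    by (simp add: gbinomial_mult_1)
  have "Suc n * (2 * Suc n choose Suc n) = 2 * (2 * n + 1) * (2 * n choose n)"
  proof -
    have a: "Suc n * (Suc (2 * n + 1) choose Suc n) = Suc (2 * n + 1) * (2 * n + 1 choose n)"
      by (rule Suc_times_binomial)
    have b: "Suc n * (Suc (2 * n) choose Suc n) = Suc (2 * n) * (2 * n choose n)"
      by (rule Suc_times_binomial)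
    have c: "(2 * n + 1 choose n) = (Suc (2 * n) choose Suc n)"
      using binomial_symmetric[of n "2 * n + 1"] by simp
    have "Suc n * (Suc n * (2 * Suc n choose Suc n)) = Suc n * (2 * (2 * n + 1) * (2 * n choose n))"
      using a b c by (simp add: algebra_simps)
    then show ?thesis by (simp only: mult_cancel1) simp
  qed
  then have "real (Suc n * (2 * Suc n choose Suc n)) = real (2 * (2 * n + 1) * (2 * n choose n))"
    by (rule arg_cong)
  then have "real (Suc n) * real (2 * Suc n choose Suc n) = 2 * (2 * real n + 1) * real (2 * n choose n)"
    by (simp only: of_nat_mult of_nat_add of_nat_numeral of_nat_1)
  also have "\<dots> = (- 4) ^ Suc n * ((- 1 / 2 - real n) * ((- 1 / 2 :: real) gchoose n))"
    unfolding Suc.IH[symmetric] by (simp add: algebra_simps)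
  also have "\<dots> = real (Suc n) * ((- 4) ^ Suc n * ((- 1 / 2 :: real) gchoose Suc n))"
    unfolding *[symmetric] by (simp only: mult_ac)
  finally show ?case by (simp only: mult_cancel_left) simp
qed simp

text \<open>The central binomial series is \<open>(1 + x)\<close> to the power \<open>- 1 / 2\<close>, with \<open>- 4 * x\<close> substituted
  for \<open>x\<close>.\<close>

lemma central_binomial_fps_square:
  "Abs_fps (\<lambda>n. real (2 * n choose n)) ^ 2 * (1 - 4 * fps_X) = 1"
proof -
  let ?l = "fps_const (-4) * fps_X :: real fps"
  have S: "Abs_fps (\<lambda>n. real (2 * n choose n)) = fps_binomial (- 1 / 2) oo ?l"
    by (simp add: fps_eq_iff gbinomial_minus_half[simplified] del: mult_minus_left)
  have "fps_binomial (- 1 / 2) ^ 2 * (1 + fps_X) = (1 :: real fps)"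
    unfolding fps_binomial_power fps_binomial_1[symmetric] fps_binomial_add_mult[symmetric] by simp
  then have "(fps_binomial (- 1 / 2) ^ 2 * (1 + fps_X)) oo ?l = 1 oo ?l" by simp
  then have "(fps_binomial (- 1 / 2) oo ?l) ^ 2 * (1 + ?l) = 1"
    by (simp add: fps_compose_mult_distrib fps_compose_power fps_compose_add_distrib)
  moreover have "1 + ?l = 1 - 4 * fps_X"
    by (simp add: numeral_fps_const flip: fps_const_neg)
  ultimately show ?thesis by (simp add: S)
qed

lemma inverse_sqrt_fps:
  "1 / fps_radical root 2 (1 - 4 * fps_X) = Abs_fps (\<lambda>n. real (2 * n choose n))"
proof -
  let ?S = "Abs_fps (\<lambda>n. real (2 * n choose n))"
  have unit: "?S * inverse ?S = 1" by (rule inverse_mult_eq_1') simp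
  have "inverse ?S ^ Suc 1 = inverse ?S ^ 2 * (?S ^ 2 * (1 - 4 * fps_X))"
    by (simp only: central_binomial_fps_square) (simp add: numeral_2_eq_2)
  also have "\<dots> = (?S * inverse ?S) ^ 2 * (1 - 4 * fps_X)"
    by (simp add: power_mult_distrib mult_ac)
  finally have "inverse ?S ^ Suc 1 = 1 - 4 * fps_X" using unit by simp
  then have "inverse ?S = fps_radical root (Suc 1) (1 - 4 * fps_X)"
    by (subst (asm) radical_unique) auto
  then have "fps_radical root 2 (1 - 4 * fps_X) = inverse ?S" by (simp add: numeral_2_eq_2)
  then show ?thesis by (simp add: fps_divide_unit)
qed

theorem mainTheorem7:
  shows "Abs_fps (\<lambda>n. real (card (avoiding_rgs n {[1,2,3,1,3], [1,2,3,2,3]}))) =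
    1 / (1 - fps_X) +
    fps_X / (2 * (1 - fps_X)) * (1 / fps_radical root 2 (1 - 4 * fps_X) - 1)"
proof -
  define A where "A = Abs_fps (\<lambda>n. real (card (avoiding_rgs n {[1,2,3,1,3], [1,2,3,2,3]})))"
  define S where "S = Abs_fps (\<lambda>n. real (2 * n choose n))"
  have half: "2 * real (2 * i + 1 choose i) = real (2 * Suc i choose Suc i)" for i
  proof -
    have "(2 * i + 1 choose Suc i) = (2 * i + 1 choose i)"
      using binomial_symmetric[of i "2 * i + 1"] by simp
    then show ?thesis by simp
  qed
  have A_0: "fps_nth A 0 = 1"
    unfolding A_def fps_nth_Abs_fps card_avoiding_rgs by simp
  have A_Suc: "fps_nth A (Suc r) = 1 + (\<Sum>i<r. real (2 * i + 1 choose i))" for r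
    unfolding A_def fps_nth_Abs_fps card_avoiding_rgs by simp
  \<comment> \<open>Multiplying by \<open>1 - fps_X\<close> takes differences of consecutive counts, which telescopes
    the sum in \<open>card_avoiding_rgs\<close>.\<close>
  have "fps_nth (A * (2 * (1 - fps_X))) n = fps_nth (2 + fps_X * (S - 1)) n" for n
  proof -
    have "A * (2 * (1 - fps_X)) = 2 * (A - fps_X * A)" by (simp add: algebra_simps)
    moreover have "fps_nth (2 * (A - fps_X * A)) n = fps_nth (2 + fps_X * (S - 1)) n"
    proof (cases n)
      case 0
      then show ?thesis by (simp add: A_0 numeral_fps_const)
    next
      case (Suc r)
      then show ?thesis
        using half by (cases r) (simp_all add: A_0 A_Suc S_def numeral_fps_const)
    qed
    ultimately show ?thesis by simp
  qed
  then have eq: "A * (2 * (1 - fps_X)) = 2 + fps_X * (S - 1)" by (simp add: fps_eq_iff)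
  have u: "inverse (2 * (1 - fps_X)) * (2 * (1 - fps_X)) = (1 :: real fps)"
    by (rule inverse_mult_eq_1) (simp add: numeral_fps_const)
  then have nz: "2 * (1 - fps_X) \<noteq> (0 :: real fps)" by force
  have v: "inverse (1 - fps_X) * (1 - fps_X) = (1 :: real fps)"
    by (rule inverse_mult_eq_1) simp
  have "(1 / (1 - fps_X) + fps_X / (2 * (1 - fps_X)) * (S - 1)) * (2 * (1 - fps_X)) =
    2 * (inverse (1 - fps_X) * (1 - fps_X)) +
    fps_X * (S - 1) * (inverse (2 * (1 - fps_X)) * (2 * (1 - fps_X)))"
    by (simp add: fps_divide_unit numeral_fps_const algebra_simps)
  also have "\<dots> = A * (2 * (1 - fps_X))" unfolding u v eq by simp
  finally have "(1 / (1 - fps_X) + fps_X / (2 * (1 - fps_X)) * (S - 1)) = A"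
    by (rule iffD1[OF mult_right_cancel[OF nz]])
  then show ?thesis by (simp add: inverse_sqrt_fps A_def S_def)
qed

end
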